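(* Let $d\ge2$ be an integer. If, for $\beta>0$, $Y_\beta$ is a random variable whose distribution is the unique invariant measure of the McKean–Vlasov process $(L_\beta(t))$ associated to the power of $d$-choices algorithm (defined in the context), then, for the convergence in distribution, $$\lim_{\beta\to+\infty}\frac{Y_\beta}{\beta}=\frac{d}{d-1}\left(1-U^{d-1}\right),$$ where $U$ is a uniform random variable on $[0,1]$.
   Context: $\mathbb{N}=\{0,1,2,\ldots\}$ and $M_1(\mathbb{N})$ is the set of probability distributions on $\mathbb{N}$. For the power of $d$-choices algorithm, for $\sigma\in M_1(\mathbb{N})$ and $l\in\mathbb{N}$, $$\Psi_{\rm pc}(\sigma,l)=\frac{\sigma([l,+\infty))^d-\sigma((l,+\infty))^d}{\sigma(\{l\})},$$ with the convention $0/0=0$. The McKean–Vlasov process $(L_\beta(t))$ is the càdlàg $\mathbb{N}$-valued process satisfying $dL_\beta(t)=\overline{\mathcal{P}}(dt\times[0,\beta\Psi_{\rm pc}(\pi(t),L_\beta(t-))])-L_\beta(t-)\,\mathcal{P}(dt)$, where $\pi(t)$ is the distribution of $L_\beta(t)$ and $\overline{\mathcal{P}}$, $\mathcal{P}$ are independent homogeneous Poisson point processes with rate 1 on $\mathbb{R}_+^2$ and $\mathbb{R}_+$ respectively. A distribution $\pi$ on $\mathbb{N}$ is invariant if, whenever $L_\beta(0)$ has distribution $\pi$, the processes $(L_\beta(t+T))_{t\ge0}$ and $(L_\beta(t))_{t\ge0}$ have the same distribution for every $T>0$. For this $\Psi_{\rm pc}$ and every $\beta>0$ there is a unique invariant distribution.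 *)

theory Defs
  imports "HOL-Probability.Probability"
begin

text \<open>
  Point processes are random sets of points. For a diffuse intensity measure \<open>I\<close> (the only case
  used below) Poisson point processes are almost surely simple, so nothing is lost. The explicit
  formula is used instead of the library's Poisson distribution because the latter is only
  specified for a positive rate, while here null sets \<open>A\<close> are included.
\<close>

definition poisson_point_process ::
  "'w measure \<Rightarrow> 'b measure \<Rightarrow> ('w \<Rightarrow> 'b set) \<Rightarrow> bool" where
  "poisson_point_process M I N \<longleftrightarrow>
     (\<forall>\<omega>\<in>space M. N \<omega> \<subseteq> space I) \<and>
     (\<forall>A\<in>sets I. emeasure I A < \<infinity> \<longrightarrow>
        (AE \<omega> in M. finite (N \<omega> \<inter> A)) \<and>
        (\<lambda>\<omega>. card (N \<omega> \<inter> A)) \<in> measurable M (count_space UNIV) \<and>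
        (\<forall>k. measure M {\<omega>\<in>space M. card (N \<omega> \<inter> A) = k} =
             measure I A ^ k / fact k * exp (- measure I A))) \<and>
     (\<forall>F. finite F \<and> disjoint F \<and> (\<forall>A\<in>F. A \<in> sets I \<and> emeasure I A < \<infinity>) \<longrightarrow>
        prob_space.indep_vars M (\<lambda>_. count_space UNIV) (\<lambda>A \<omega>. card (N \<omega> \<inter> A)) F)"

definition point_process_events ::
  "'w measure \<Rightarrow> 'b measure \<Rightarrow> ('w \<Rightarrow> 'b set) \<Rightarrow> 'w set set" where
  "point_process_events M I N =
     sigma_sets (space M)
       {{\<omega>\<in>space M. card (N \<omega> \<inter> A) = k} | A k. A \<in> sets I \<and> emeasure I A < \<infinity>}"

definition half_line :: "real measure" where
  "half_line = restrict_space lborel {0..}"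

definition quadrant :: "(real \<times> real) measure" where
  "quadrant = restrict_space lborel ({0..} \<times> {0..})"

definition cadlag :: "(real \<Rightarrow> 'a::topological_space) \<Rightarrow> bool" where
  "cadlag f \<longleftrightarrow>
     (\<forall>t\<ge>0. (f \<longlongrightarrow> f t) (at_right t)) \<and> (\<forall>t>0. \<exists>l. (f \<longlongrightarrow> l) (at_left t))"

text \<open>The convention \<open>0 / 0 = 0\<close> is that of HOL: the numerator vanishes with the denominator.\<close>

definition psi_pc :: "nat \<Rightarrow> nat measure \<Rightarrow> nat \<Rightarrow> real" where
  "psi_pc d \<sigma> l = (measure \<sigma> {l..} ^ d - measure \<sigma> {l<..} ^ d) / measure \<sigma> {l}"

text \<open>
  The stochastic differential equation is stated in integrated form on \<open>(0, t]\<close>; the integrals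
  against the point processes are a cardinality and a sum over the points. As usual for such an
  equation, the initial value is independent of the pair of driving processes.
\<close>

definition mckean_vlasov ::
  "(nat measure \<Rightarrow> nat \<Rightarrow> real) \<Rightarrow> real \<Rightarrow> 'w measure \<Rightarrow>
   ('w \<Rightarrow> (real \<times> real) set) \<Rightarrow> ('w \<Rightarrow> real set) \<Rightarrow> (real \<Rightarrow> 'w \<Rightarrow> nat) \<Rightarrow> bool" where
  "mckean_vlasov \<Psi> \<beta> M Pbar P L \<longleftrightarrow>
     prob_space M \<and>
     poisson_point_process M quadrant Pbar \<and>
     poisson_point_process M half_line P \<and>
     prob_space.indep_set M (point_process_events M quadrant Pbar)
       (point_process_events M half_line P) \<and>
     (\<forall>t\<ge>0. L t \<in> measurable M (count_space UNIV)) \<and>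
     prob_space.indep_set M {L 0 -` B \<inter> space M | B. True}
       (sigma_sets (space M)
         (point_process_events M quadrant Pbar \<union> point_process_events M half_line P)) \<and>
     (\<forall>\<omega>\<in>space M. cadlag (\<lambda>t. L t \<omega>)) \<and>
     (AE \<omega> in M. \<forall>t\<ge>0.
        int (L t \<omega>) = int (L 0 \<omega>)
          + int (card {(s, x) \<in> Pbar \<omega>. s \<in> {0<..t} \<and>
               x \<in> {0..\<beta> * \<Psi> (distr M (count_space UNIV) (L s)) (Lim (at_left s) (\<lambda>r. L r \<omega>))}})
          - (\<Sum>s\<in>P \<omega> \<inter> {0<..t}. int (Lim (at_left s) (\<lambda>r. L r \<omega>))))"

definition path_law :: "'w measure \<Rightarrow> (real \<Rightarrow> 'w \<Rightarrow> nat) \<Rightarrow> (real \<Rightarrow> nat) measure" where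
  "path_law M X =
     distr M (PiM {0..} (\<lambda>_. count_space UNIV)) (\<lambda>\<omega>. \<lambda>t\<in>{0..}. X t \<omega>)"

text \<open>
  The process started from a given distribution exists, so the existence clause is no
  restriction on \<open>\<pi>\<close>. It is there because the sample type is a parameter: on a type too small to
  carry Poisson processes the last clause alone would hold vacuously for every \<open>\<pi>\<close>.
\<close>

definition invariant_distribution ::
  "'w itself \<Rightarrow> (nat measure \<Rightarrow> nat \<Rightarrow> real) \<Rightarrow> real \<Rightarrow> nat measure \<Rightarrow> bool" where
  "invariant_distribution _ \<Psi> \<beta> \<pi> \<longleftrightarrow>
     prob_space \<pi> \<and> sets \<pi> = sets (count_space UNIV) \<and>
     (\<exists>(M :: 'w measure) Pbar P L.
        mckean_vlasov \<Psi> \<beta> M Pbar P L \<and> distr M (count_space UNIV) (L 0) = \<pi>) \<and>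
     (\<forall>(M :: 'w measure) Pbar P L.
        mckean_vlasov \<Psi> \<beta> M Pbar P L \<and> distr M (count_space UNIV) (L 0) = \<pi> \<longrightarrow>
        (\<forall>T>0. path_law M (\<lambda>t. L (t + T)) = path_law M L))"

text \<open>Convergence in distribution along an arbitrary filter.\<close>

definition weak_conv_along :: "'i filter \<Rightarrow> ('i \<Rightarrow> real measure) \<Rightarrow> real measure \<Rightarrow> bool" where
  "weak_conv_along F \<mu> \<nu> \<longleftrightarrow>
     (\<forall>x. isCont (cdf \<nu>) x \<longrightarrow> ((\<lambda>i. cdf (\<mu> i) x) \<longlongrightarrow> cdf \<nu> x) F)"

lemma weak_conv_along_sequentially: "weak_conv_along sequentially \<mu> \<nu> \<longleftrightarrow> weak_conv_m \<mu> \<nu>"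
  by (simp add: weak_conv_along_def weak_conv_m_def weak_conv_def)

end

theory Submission
  imports Defs "HOL-Real_Asymp.Real_Asymp"
begin

text \<open>
  Fix \<open>\<beta>\<close>, let \<open>\<pi>\<close> be the invariant distribution and \<open>\<xi>\<^sub>l = \<pi>([l, \<infinity>))\<close>. When the process
  starts from \<open>\<pi>\<close>, the law of \<open>L(t)\<close> does not depend on \<open>t\<close>, so the nonlinearity disappears: the
  process jumps from \<open>l\<close> to \<open>l + 1\<close> at rate \<open>\<beta> \<Psi>(\<pi>, l)\<close> and from \<open>l\<close> to \<open>0\<close> at rate \<open>1\<close>. In
  equilibrium the flow out of \<open>(l, \<infinity>)\<close>, which has rate \<open>\<xi>\<^bsub>l+1\<^esub>\<close>, equals the flow into it, which has
  rate \<open>\<pi>({l}) \<beta> \<Psi>(\<pi>, l) = \<beta> (\<xi>\<^sub>l\<^sup>d - \<xi>\<^bsub>l+1\<^esub>\<^sup>d)\<close>. This is the balance equation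
  \<open>\<xi>\<^bsub>l+1\<^esub> = \<beta> (\<xi>\<^sub>l\<^sup>d - \<xi>\<^bsub>l+1\<^esub>\<^sup>d)\<close> of \<open>invariant_distribution_balance\<close>.

  The two flows are read off at time \<open>0\<close>. The bound \<open>\<Psi> \<le> d\<close> confines the arrivals
  up to a small time \<open>t\<close> to the points of the first process in the box \<open>(0, t] \<times> [0, \<beta> d]\<close>. Unless
  this box and \<open>(0, t]\<close> contain two points or more in total, which has probability \<open>O(t\<^sup>2)\<close>, the
  value \<open>L(t)\<close> is an explicit function of \<open>L(0)\<close> and of the points
  (\<open>path_with_at_most_one_point\<close>). As \<open>L(0)\<close> is independent of the points, the probabilities of
  both transitions follow from the Poisson distribution to first order in \<open>t\<close>.

  The balance equation is an implicit Euler scheme with step \<open>1 / \<beta>\<close> for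
  \<open>h = - d h\<^bsup>d-1\<^esup> h'\<close>, that is, \<open>(h\<^bsup>d-1\<^esup>)' = - (d - 1) / d\<close>. Indeed, each step lowers
  \<open>\<xi>\<^sub>l\<^bsup>d-1\<^esup>\<close> by almost exactly \<open>(d - 1) / (d \<beta>)\<close>: by weighted AM-GM this is an upper bound for the
  decrease, and, as long as \<open>\<xi>\<^sub>l\<close> is not too small, it is also a lower bound up to a factor close
  to \<open>1\<close>. So \<open>P(Y\<^sub>\<beta> / \<beta> > x)\<close> tends to
  \<open>max(0, 1 - (d - 1) x / d)\<^bsup>1/(d-1)\<^esup>\<close> for \<open>x \<ge> 0\<close>, which is the probability that
  \<open>d / (d - 1) (1 - U\<^bsup>d-1\<^esup>)\<close> exceeds \<open>x\<close>.
\<close>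

section \<open>Paths of the equation driven by at most one point\<close>

lemma path_constant_before_points:
  fixes L :: "real \<Rightarrow> nat" and r :: "nat \<Rightarrow> real"
  assumes eq: "\<And>t. t \<ge> 0 \<Longrightarrow> int (L t) = int (L 0)
      + int (card {(s, x) \<in> B. s \<in> {0<..t} \<and> x \<in> {0..r (Lim (at_left s) L)}})
      - (\<Sum>s\<in>P \<inter> {0<..t}. int (Lim (at_left s) L))"
    and r: "\<And>l. r l \<le> K"
    and u: "u \<ge> 0" "B \<inter> {0<..u} \<times> {0..K} = {}" "P \<inter> {0<..u} = {}"
  shows "L u = L 0"
proof -
  have "{(s, x) \<in> B. s \<in> {0<..u} \<and> x \<in> {0..r (Lim (at_left s) L)}}
      \<subseteq> B \<inter> {0<..u} \<times> {0..K}"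
    by (auto intro: order.trans[OF _ r])
  then have "{(s, x) \<in> B. s \<in> {0<..u} \<and> x \<in> {0..r (Lim (at_left s) L)}} = {}"
    using u by blast
  then have "int (L u) = int (L 0)" using eq[OF u(1)] u(3) by (simp only: card.empty) simp
  then show ?thesis by simp
qed

lemma Lim_at_left_of_constant:
  fixes L :: "real \<Rightarrow> nat"
  assumes "0 < s" and "\<And>u. 0 \<le> u \<Longrightarrow> u < s \<Longrightarrow> L u = a"
  shows "Lim (at_left s) L = a"
proof -
  have "\<forall>\<^sub>F u in at_left s. L u = a"
    unfolding eventually_at_left_field using assms by (intro exI[of _ 0]) auto
  then have "(L \<longlongrightarrow> a) (at_left s)" by (rule tendsto_eventually)
  then show ?thesis by (intro tendsto_Lim) auto
qed

text \<open>
  Before its only driving point the path is constant, so every left limit in the equation equals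
  the initial value. The equation is then no longer implicit and can be evaluated. The
  bound \<open>K\<close> on the rates makes the condition on the points independent of the path.
\<close>

lemma path_with_at_most_one_point:
  fixes L :: "real \<Rightarrow> nat" and r :: "nat \<Rightarrow> real"
  assumes eq: "\<And>t. t \<ge> 0 \<Longrightarrow> int (L t) = int (L 0)
      + int (card {(s, x) \<in> B. s \<in> {0<..t} \<and> x \<in> {0..r (Lim (at_left s) L)}})
      - (\<Sum>s\<in>P \<inter> {0<..t}. int (Lim (at_left s) L))"
    and r: "\<And>l. r l \<le> K"
    and t: "t \<ge> 0"
    and fin: "finite (B \<inter> {0<..t} \<times> {0..K})" "finite (P \<inter> {0<..t})"
    and one: "card (B \<inter> {0<..t} \<times> {0..K}) + card (P \<inter> {0<..t}) \<le> 1"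
  shows "L t = (if P \<inter> {0<..t} = {}
                then L 0 + card (B \<inter> {0<..t} \<times> {0..r (L 0)}) else 0)"
proof -
  have const: "L u = L 0"
    if "u \<ge> 0" "B \<inter> {0<..u} \<times> {0..K} = {}" "P \<inter> {0<..u} = {}" for u
    by (rule path_constant_before_points[OF eq r that])
  have sub: "{(s, x) \<in> B. s \<in> {0<..t} \<and> x \<in> {0..r (Lim (at_left s) L)}}
      \<subseteq> B \<inter> {0<..t} \<times> {0..K}"
    by (auto intro: order.trans[OF _ r])
  show ?thesis
  proof (cases "P \<inter> {0<..t} = {}")
    case False
    then have "card (P \<inter> {0<..t}) \<ge> 1"
      using fin by (metis One_nat_def Suc_leI card_gt_0_iff)
    then have card: "card (B \<inter> {0<..t} \<times> {0..K}) = 0" "card (P \<inter> {0<..t}) = 1"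
      using one by auto
    then obtain s where s: "P \<inter> {0<..t} = {s}" by (auto simp: card_1_singleton_iff)
    have B: "B \<inter> {0<..t} \<times> {0..K} = {}" using card fin by auto
    have "0 < s" "s \<le> t" using s by auto
    have "Lim (at_left s) L = L 0"
    proof (rule Lim_at_left_of_constant[OF \<open>0 < s\<close>])
      fix u assume u: "0 \<le> u" "u < s"
      have "B \<inter> {0<..u} \<times> {0..K} \<subseteq> B \<inter> {0<..t} \<times> {0..K}"
        using u \<open>s \<le> t\<close> by (intro Int_mono Sigma_mono) auto
      moreover have "P \<inter> {0<..u} \<subseteq> P \<inter> {0<..t} - {s}" using u \<open>s \<le> t\<close> by auto
      ultimately show "L u = L 0" using u B s by (intro const) auto
    qed
    moreover have "{(s, x) \<in> B. s \<in> {0<..t} \<and> x \<in> {0..r (Lim (at_left s) L)}} = {}"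
      using sub B by blast
    ultimately show ?thesis using eq[OF t] s by (simp only: card.empty) simp
  next
    case P: True
    have lim: "Lim (at_left s) L = L 0" if sx: "(s, x) \<in> B \<inter> {0<..t} \<times> {0..K}" for s x
    proof (rule Lim_at_left_of_constant)
      show "0 < s" using sx by auto
      fix u assume u: "0 \<le> u" "u < s"
      have "card (B \<inter> {0<..t} \<times> {0..K}) \<noteq> 0" using fin sx by auto
      then have "card (B \<inter> {0<..t} \<times> {0..K}) = 1" using one by linarith
      then obtain p where "B \<inter> {0<..t} \<times> {0..K} = {p}" by (rule card_1_singletonE)
      then have B: "B \<inter> {0<..t} \<times> {0..K} = {(s, x)}" using sx by simp
      have "B \<inter> {0<..u} \<times> {0..K} \<subseteq> B \<inter> {0<..t} \<times> {0..K} - {(s, x)}"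
        using u sx by auto
      moreover have "P \<inter> {0<..u} \<subseteq> P \<inter> {0<..t}" using u sx by auto
      ultimately show "L u = L 0" using u B P by (intro const) auto
    qed
    have "{(s, x) \<in> B. s \<in> {0<..t} \<and> x \<in> {0..r (Lim (at_left s) L)}}
      = B \<inter> {0<..t} \<times> {0..r (L 0)}"
      (is "?lhs = ?rhs")
    proof -
      have "p \<in> ?lhs \<longleftrightarrow> p \<in> ?rhs" for p
      proof (cases "p \<in> B \<inter> {0<..t} \<times> {0..K}")
        case True
        then show ?thesis using lim[of "fst p" "snd p"] by (cases p) auto
      next
        case False
        moreover have "?rhs \<subseteq> B \<inter> {0<..t} \<times> {0..K}"
          by (auto intro: order.trans[OF _ r])
        ultimately show ?thesis using sub by blast
      qed
      then show ?thesis by blast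
    qed
    then show ?thesis using eq[OF t] P by simp
  qed
qed

section \<open>Jump rates and Poisson counts\<close>

lemma tail_eq_point_plus_tail:
  fixes \<pi> :: "nat measure"
  assumes "prob_space \<pi>" "sets \<pi> = UNIV"
  shows "measure \<pi> {l..} = measure \<pi> {l} + measure \<pi> {l<..}"
proof -
  interpret prob_space \<pi> by fact
  have "{l..} = {l} \<union> {l<..}" by auto
  then show ?thesis using finite_measure_Union[of "{l}" "{l<..}"] assms by simp
qed

text \<open>
  With \<open>a = \<pi>([l, \<infinity>))\<close> and \<open>b = \<pi>((l, \<infinity>))\<close> the rate is the difference quotient of \<open>u \<mapsto> u\<^sup>d\<close>
  between \<open>b\<close> and \<open>a\<close>, so on \<open>[0, 1]\<close> it is at most \<open>d\<close>.
\<close>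

lemma psi_pc_bounds:
  fixes \<pi> :: "nat measure"
  assumes "prob_space \<pi>" "sets \<pi> = UNIV"
  shows psi_pc_nonneg: "0 \<le> psi_pc d \<pi> l"
    and psi_pc_le: "psi_pc d \<pi> l \<le> real d"
    and psi_pc_mult: "measure \<pi> {l} * psi_pc d \<pi> l = measure \<pi> {l..} ^ d - measure \<pi> {l<..} ^ d"
proof -
  interpret prob_space \<pi> by fact
  define a b where "a = measure \<pi> {l..}" and "b = measure \<pi> {l<..}"
  have m: "measure \<pi> {l} = a - b"
    using tail_eq_point_plus_tail[OF assms] by (simp add: a_def b_def)
  have ab: "0 \<le> b" "b \<le> a" "a \<le> 1"
    using m measure_nonneg[of \<pi> "{l}"] by (auto simp: a_def b_def)
  have "a ^ d - b ^ d = (a - b) * (\<Sum>i<d. b ^ (d - Suc i) * a ^ i)"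
    by (rule power_diff_sumr2)
  also have "\<dots> \<le> (a - b) * (\<Sum>i<d. 1)"
    using ab by (intro mult_left_mono sum_mono mult_le_one power_le_one zero_le_power) auto
  finally have le: "a ^ d - b ^ d \<le> (a - b) * real d" by simp
  have ge: "b ^ d \<le> a ^ d" using ab by (intro power_mono) auto
  have psi: "psi_pc d \<pi> l = (a ^ d - b ^ d) / (a - b)"
    by (simp add: psi_pc_def m flip: a_def b_def)
  show "0 \<le> psi_pc d \<pi> l" using ab ge by (simp add: psi)
  show "psi_pc d \<pi> l \<le> real d"
    using le ab by (cases "a = b") (auto simp: psi divide_le_eq mult.commute)
  show "measure \<pi> {l} * psi_pc d \<pi> l = measure \<pi> {l..} ^ d - measure \<pi> {l<..} ^ d"
    by (cases "a = b") (auto simp: psi m simp flip: a_def b_def)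
qed

lemma path_law_eq_imp_distr_eq:
  fixes X Y :: "real \<Rightarrow> 'w \<Rightarrow> nat"
  assumes "path_law M X = path_law M Y" "t \<ge> 0"
    and "\<And>t. t \<ge> 0 \<Longrightarrow> X t \<in> measurable M (count_space UNIV)"
    and "\<And>t. t \<ge> 0 \<Longrightarrow> Y t \<in> measurable M (count_space UNIV)"
  shows "distr M (count_space UNIV) (X t) = distr M (count_space UNIV) (Y t)"
proof -
  have *: "distr (path_law M Z) (count_space UNIV) (\<lambda>f. f t) = distr M (count_space UNIV) (Z t)"
    if Z: "\<And>t. t \<ge> 0 \<Longrightarrow> Z t \<in> measurable M (count_space UNIV)" for Z :: "real \<Rightarrow> 'w \<Rightarrow> nat"
  proof -
    have "(\<lambda>\<omega>. \<lambda>t\<in>{0..}. Z t \<omega>) \<in> measurable M (PiM {0..} (\<lambda>_. count_space UNIV))"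
      by (intro measurable_restrict) (use Z in auto)
    moreover have "(\<lambda>f. f t) \<in> measurable (PiM {0..} (\<lambda>_. count_space UNIV)) (count_space UNIV)"
      by (rule measurable_component_singleton) (use \<open>t \<ge> 0\<close> in auto)
    ultimately show ?thesis using \<open>t \<ge> 0\<close>
      unfolding path_law_def by (subst distr_distr) (auto simp: comp_def)
  qed
  show ?thesis using *[of X] *[of Y] assms by simp
qed

lemma half_line_interval:
  assumes "t \<ge> 0"
  shows "{0<..t} \<in> sets half_line" "emeasure half_line {0<..t} = ennreal t"
    "measure half_line {0<..t} = t"
proof -
  have s: "{0<..t} \<subseteq> {0::real..}" by auto
  show "{0<..t} \<in> sets half_line"
    unfolding half_line_def using s by (subst sets_restrict_space_iff) auto
  show e: "emeasure half_line {0<..t} = ennreal t"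
    unfolding half_line_def using s assms by (subst emeasure_restrict_space) auto
  show "measure half_line {0<..t} = t" using e assms by (simp add: measure_def)
qed

lemma quadrant_box:
  assumes "t \<ge> 0" "K \<ge> 0"
  shows "{0<..t} \<times> {0..K} \<in> sets quadrant" "emeasure quadrant ({0<..t} \<times> {0..K}) = ennreal (t * K)"
    "measure quadrant ({0<..t} \<times> {0..K}) = t * K"
proof -
  have s: "{0<..t} \<times> {0..K} \<subseteq> {0::real..} \<times> {0::real..}" by auto
  have b: "{0<..t} \<times> {0..K} \<in> sets (lborel :: (real \<times> real) measure)"
    by (simp add: borel_prod[symmetric])
  have b': "{0::real..} \<times> {0::real..} \<in> sets (lborel :: (real \<times> real) measure)"
    by (simp add: borel_prod[symmetric])
  show "{0<..t} \<times> {0..K} \<in> sets quadrant"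
    unfolding quadrant_def using s b b' by (subst sets_restrict_space_iff) auto
  have "emeasure (lborel :: (real \<times> real) measure) ({0<..t} \<times> {0..K}) = ennreal t * ennreal K"
    using assms by (subst lborel_prod[symmetric], subst lborel.emeasure_pair_measure_Times) auto
  then show e: "emeasure quadrant ({0<..t} \<times> {0..K}) = ennreal (t * K)"
    unfolding quadrant_def using s b' assms
    by (subst emeasure_restrict_space) (auto simp: ennreal_mult)
  show "measure quadrant ({0<..t} \<times> {0..K}) = t * K" using e assms by (simp add: measure_def)
qed

lemma poisson_point_processD:
  assumes "poisson_point_process M I N" "A \<in> sets I" "emeasure I A < \<infinity>"
  shows "AE \<omega> in M. finite (N \<omega> \<inter> A)"
    and "(\<lambda>\<omega>. card (N \<omega> \<inter> A)) \<in> measurable M (count_space UNIV)"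
    and "measure M {\<omega>\<in>space M. card (N \<omega> \<inter> A) = k} =
          measure I A ^ k / fact k * exp (- measure I A)"
    and "{\<omega>\<in>space M. card (N \<omega> \<inter> A) = k} \<in> point_process_events M I N"
  using assms unfolding poisson_point_process_def point_process_events_def by auto


lemma (in prob_space) prob_indep_counts_sum_le_1:
  fixes N0 N2 :: "'a \<Rightarrow> nat"
  assumes "indep_set \<A> \<B>"
    and "\<And>k. {\<omega>\<in>space M. N0 \<omega> = k} \<in> \<A>" "\<And>k. {\<omega>\<in>space M. N2 \<omega> = k} \<in> \<B>"
  shows "prob {\<omega>\<in>space M. N0 \<omega> + N2 \<omega> \<le> 1} =
    prob {\<omega>\<in>space M. N0 \<omega> = 0} * prob {\<omega>\<in>space M. N2 \<omega> = 0}
    + prob {\<omega>\<in>space M. N0 \<omega> = 1} * prob {\<omega>\<in>space M. N2 \<omega> = 0}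
    + prob {\<omega>\<in>space M. N0 \<omega> = 0} * prob {\<omega>\<in>space M. N2 \<omega> = 1}"
proof -
  define E where "E i j = {\<omega>\<in>space M. N0 \<omega> = i} \<inter> {\<omega>\<in>space M. N2 \<omega> = j}" for i j
  have "\<A> \<subseteq> events" "\<B> \<subseteq> events" using assms(1) by (auto simp: indep_set_def indep_sets_def split: bool.splits)
  then have ev: "E i j \<in> events" for i j
    unfolding E_def using assms(2,3) by blast
  have pE: "prob (E i j) = prob {\<omega>\<in>space M. N0 \<omega> = i} * prob {\<omega>\<in>space M. N2 \<omega> = j}" for i j
    unfolding E_def by (rule indep_setD[OF assms(1) assms(2) assms(3)])
  have "{\<omega>\<in>space M. N0 \<omega> + N2 \<omega> \<le> 1} = E 0 0 \<union> E 1 0 \<union> E 0 1"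
    unfolding E_def by (auto simp: le_Suc_eq)
  also have "prob \<dots> = prob (E 0 0) + prob (E 1 0) + prob (E 0 1)"
    using ev by (subst finite_measure_Union finite_measure_Union; (auto simp: E_def)?)+
  finally show ?thesis by (simp only: pE)
qed

section \<open>The balance equation\<close>

lemma (in prob_space) prob_diff_le_of_AE_iff:
  assumes "AE \<omega> in M. \<omega> \<notin> R \<longrightarrow> (\<omega> \<in> A \<longleftrightarrow> \<omega> \<in> B)"
    and [measurable]: "A \<in> events" "B \<in> events" "R \<in> events"
  shows "\<bar>prob A - prob B\<bar> \<le> prob R"
proof -
  have "AE \<omega> in M. \<omega> \<in> A \<longrightarrow> \<omega> \<in> B \<union> R" "AE \<omega> in M. \<omega> \<in> B \<longrightarrow> \<omega> \<in> A \<union> R"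
    using assms(1) by (auto elim: eventually_mono)
  then have "prob A \<le> prob (B \<union> R)" "prob B \<le> prob (A \<union> R)"
    using assms(2-4) by (auto intro: finite_measure_mono_AE)
  moreover have "prob (B \<union> R) \<le> prob B + prob R" "prob (A \<union> R) \<le> prob A + prob R"
    using assms(2-4) by (auto intro: measure_Un_le)
  ultimately show ?thesis by linarith
qed

lemma (in prob_space) exit_eq_entrance:
  assumes "prob A = prob B" "A \<in> events" "B \<in> events"
  shows "prob (A - B) = prob (B - A)"
  using assms finite_measure_Diff'[of A B] finite_measure_Diff'[of B A] by (simp only: Int_commute[of B A])

lemma sets_Collect_counts:
  fixes f g :: "'w \<Rightarrow> nat"
  assumes [measurable]: "f \<in> measurable M (count_space UNIV)" "g \<in> measurable M (count_space UNIV)"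
  shows "{\<omega>\<in>space M. Q (f \<omega>) (g \<omega>)} \<in> sets M"
  by measurable

text \<open>
  The left-hand side compares the probability of exactly one point of a rate-one process with that
  of at least one point of a rate-\<open>c\<close> process up to time \<open>t\<close>; the right-hand side is twice the
  probability that a process of rate \<open>1 + K\<close> has at least two points, which is \<open>o(t)\<close>.
  Dividing by \<open>t\<close> leaves the first-order terms.
\<close>

lemma rates_agree_of_small_time:
  fixes x m c K :: real
  assumes "\<And>t. t > 0 \<Longrightarrow> \<bar>x * (t * exp (- t)) - m * (1 - exp (- (c * t)))\<bar>
    \<le> 2 * (1 - exp (- ((1 + K) * t)) * (1 + (1 + K) * t))"
  shows "x = m * c"
proof -
  have l1: "((\<lambda>t. (x * (t * exp (- t)) - m * (1 - exp (- (c * t)))) / t) \<longlongrightarrow> x - m * c) (at_right 0)"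
    by real_asymp
  have l2: "((\<lambda>t. (2 * (1 - exp (- ((1 + K) * t)) * (1 + (1 + K) * t))) / t) \<longlongrightarrow> 0) (at_right 0)"
    by real_asymp
  have ev: "\<forall>\<^sub>F t in at_right 0. \<bar>(x * (t * exp (- t)) - m * (1 - exp (- (c * t)))) / t\<bar> \<le>
     (2 * (1 - exp (- ((1 + K) * t)) * (1 + (1 + K) * t))) / t"
    using eventually_at_right_less[of 0]
    by eventually_elim (use assms in \<open>auto intro!: divide_right_mono\<close>)
  have "\<bar>x - m * c\<bar> \<le> 0"
    by (rule tendsto_le[OF _ l2 tendsto_rabs[OF l1] ev]) simp
  then show ?thesis by simp
qed

text \<open>
  Since \<open>L(0)\<close> and \<open>L(t)\<close> have the same law, leaving \<open>(l, \<infinity>)\<close> between these times is as likely as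
  entering it. Up to an event of probability \<open>O(t\<^sup>2)\<close>, leaving means \<open>L(0) > l\<close> and one departure,
  and entering means \<open>L(0) = l\<close> and an arrival below height \<open>\<beta> \<Psi>(\<pi>, l)\<close>.
\<close>

lemma invariant_distribution_balance:
  assumes "\<beta> > 0" and inv: "invariant_distribution TYPE('w) (psi_pc d) \<beta> \<pi>"
  shows "measure \<pi> {l<..} = \<beta> * (measure \<pi> {l..} ^ d - measure \<pi> {l<..} ^ d)"
proof -
  from inv obtain M :: "'w measure" and Pbar P L where
    mv: "mckean_vlasov (psi_pc d) \<beta> M Pbar P L" and init: "distr M (count_space UNIV) (L 0) = \<pi>"
    unfolding invariant_distribution_def by blast
  have \<pi>: "prob_space \<pi>" "sets \<pi> = UNIV" using inv by (auto simp: invariant_distribution_def)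
  have stat: "path_law M (\<lambda>t. L (t + T)) = path_law M L" if "T > 0" for T
    using inv mv init that unfolding invariant_distribution_def by blast
  note mv' = mv[unfolded mckean_vlasov_def]
  interpret prob_space M using mv' by blast
  have ppp: "poisson_point_process M quadrant Pbar" "poisson_point_process M half_line P"
    and indep: "indep_set (point_process_events M quadrant Pbar) (point_process_events M half_line P)"
    and L: "\<And>t. t \<ge> 0 \<Longrightarrow> L t \<in> measurable M (count_space UNIV)"
    and indep0: "indep_set {L 0 -` B \<inter> space M | B. True}
       (sigma_sets (space M)
         (point_process_events M quadrant Pbar \<union> point_process_events M half_line P))"
    using mv' by blast+
  have law: "distr M (count_space UNIV) (L s) = \<pi>" if "s \<ge> 0" for s
  proof (cases "s = 0")
    case False
    then have "distr M (count_space UNIV) (L (0 + s)) = distr M (count_space UNIV) (L 0)"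
      using that by (intro path_law_eq_imp_distr_eq[OF stat]) (auto intro: L)
    then show ?thesis using init by simp
  qed (use init in auto)
  have prob_L: "prob {\<omega>\<in>space M. L s \<omega> \<in> A} = measure \<pi> A" if "s \<ge> 0" for s A
    using that by (subst law[OF that, symmetric], subst measure_distr)
      (auto intro!: arg_cong[where f = prob] intro: L)
  define K where "K = \<beta> * real d"
  define r where "r = (\<lambda>j. \<beta> * psi_pc d \<pi> j)"
  have r: "0 \<le> r j" "r j \<le> K" for j
    using psi_pc_bounds[OF \<pi>] \<open>\<beta> > 0\<close> by (auto simp: r_def K_def)
  have "K \<ge> 0" using r order.trans by blast
  have sde: "AE \<omega> in M. \<forall>t\<ge>0. int (L t \<omega>) = int (L 0 \<omega>)
      + int (card {(s, x) \<in> Pbar \<omega>. s \<in> {0<..t} \<and> x \<in> {0..r (Lim (at_left s) (\<lambda>r. L r \<omega>))}})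
      - (\<Sum>s\<in>P \<omega> \<inter> {0<..t}. int (Lim (at_left s) (\<lambda>r. L r \<omega>)))"
  proof -
    have "{(s, x) \<in> Pbar \<omega>. s \<in> {0<..t} \<and> x \<in> {0..\<beta> * psi_pc d (distr M (count_space UNIV) (L s))
            (Lim (at_left s) (\<lambda>r. L r \<omega>))}} =
          {(s, x) \<in> Pbar \<omega>. s \<in> {0<..t} \<and> x \<in> {0..r (Lim (at_left s) (\<lambda>r. L r \<omega>))}}" for t \<omega>
      by (auto simp: r_def law)
    then show ?thesis using mv' by simp
  qed
  have "measure \<pi> {l<..} = measure \<pi> {l} * r l"
  proof (rule rates_agree_of_small_time)
    fix t :: real assume "t > 0"
    then have [simp]: "t \<ge> 0" by simp
    note interval = half_line_interval[OF \<open>t \<ge> 0\<close>]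
    have "emeasure half_line {0<..t} < \<infinity>" by (simp add: interval(2))
    note poisson_P = poisson_point_processD[OF ppp(2) interval(1) this, unfolded interval(3)]
    note box = quadrant_box[OF \<open>t \<ge> 0\<close>]
    have "emeasure quadrant ({0<..t} \<times> {0..c}) < \<infinity>" if "c \<ge> 0" for c
      by (simp add: box(2)[OF that])
    note poisson_B = poisson_point_processD[OF ppp(1) box(1) this]
    define N where "N \<omega> = card (P \<omega> \<inter> {0<..t})" for \<omega>
    define B where "B c \<omega> = card (Pbar \<omega> \<inter> {0<..t} \<times> {0..c})" for c \<omega>
    have N: "N \<in> measurable M (count_space UNIV)"
      unfolding N_def by (rule poisson_P(2))
    have B: "B c \<in> measurable M (count_space UNIV)" if "c \<ge> 0" for c
      unfolding B_def by (rule poisson_B(2)[OF that that])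
    note L0 = L[OF order_refl] and Lt = L[OF \<open>t \<ge> 0\<close>]
    (* Exit from and entrance into (l, infinity) between the times 0 and t; down1 and up1 describe
       the same transitions through the driving points, and almost surely agree with them outside R. *)
    define down where "down = {\<omega>\<in>space M. l < L 0 \<omega>} - {\<omega>\<in>space M. l < L t \<omega>}"
    define up where "up = {\<omega>\<in>space M. l < L t \<omega>} - {\<omega>\<in>space M. l < L 0 \<omega>}"
    define down1 where "down1 = {\<omega>\<in>space M. l < L 0 \<omega> \<and> N \<omega> = 1}"
    define up1 where "up1 = {\<omega>\<in>space M. L 0 \<omega> = l \<and> B (r l) \<omega> \<noteq> 0}"
    define R where "R = {\<omega>\<in>space M. \<not> N \<omega> + B K \<omega> \<le> 1}"
    have ev: "down \<in> events" "up \<in> events" "down1 \<in> events" "up1 \<in> events" "R \<in> events"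
      using sets_Collect_counts[OF L0 L0, of "\<lambda>i _. l < i"]
        sets_Collect_counts[OF Lt Lt, of "\<lambda>i _. l < i"]
        sets_Collect_counts[OF L0 N, of "\<lambda>i j. l < i \<and> j = 1"]
        sets_Collect_counts[OF L0 B[OF r(1)], of "\<lambda>i j. i = l \<and> j \<noteq> 0" l]
        sets_Collect_counts[OF N B[OF \<open>K \<ge> 0\<close>], of "\<lambda>i j. \<not> i + j \<le> 1"]
      unfolding down_def up_def down1_def up1_def R_def by (blast intro: sets.Diff)+
    have iff: "AE \<omega> in M. \<omega> \<in> space M - R \<longrightarrow>
        (\<omega> \<in> down \<longleftrightarrow> \<omega> \<in> down1) \<and> (\<omega> \<in> up \<longleftrightarrow> \<omega> \<in> up1)"
      using sde poisson_P(1) poisson_B(1)[OF \<open>K \<ge> 0\<close> \<open>K \<ge> 0\<close>]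
    proof eventually_elim
      case (elim \<omega>)
      show ?case
      proof
        assume \<omega>: "\<omega> \<in> space M - R"
        then have one: "B K \<omega> + N \<omega> \<le> 1" by (auto simp: R_def)
        have "N \<omega> = 0 \<longleftrightarrow> P \<omega> \<inter> {0<..t} = {}"
          using elim(2) by (simp add: N_def)
        with path_with_at_most_one_point[where L = "\<lambda>t. L t \<omega>", OF elim(1)[rule_format] r(2)
            \<open>t \<ge> 0\<close> elim(3,2) one[unfolded B_def N_def]]
        have path: "L t \<omega> = (if N \<omega> = 0 then L 0 \<omega> + B (r (L 0 \<omega>)) \<omega> else 0)"
          by (simp only: B_def)
        have "B (r j) \<omega> \<le> B K \<omega>" for j
          unfolding B_def using elim(3) order.trans[OF _ r(2)[of j]]
          by (intro card_mono) auto
        from this[of l] this[of "L 0 \<omega>"] show "(\<omega> \<in> down \<longleftrightarrow> \<omega> \<in> down1) \<and> (\<omega> \<in> up \<longleftrightarrow> \<omega> \<in> up1)"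
          using \<omega> one path unfolding down_def up_def down1_def up1_def
          by (cases "L 0 \<omega> = l") (auto split: if_splits)
      qed
    qed
    have "AE \<omega> in M. \<omega> \<notin> R \<longrightarrow> (\<omega> \<in> down \<longleftrightarrow> \<omega> \<in> down1)"
      "AE \<omega> in M. \<omega> \<notin> R \<longrightarrow> (\<omega> \<in> up \<longleftrightarrow> \<omega> \<in> up1)"
      by (use iff AE_space in \<open>eventually_elim, blast\<close>)+
    then have "\<bar>prob down - prob down1\<bar> \<le> prob R" "\<bar>prob up - prob up1\<bar> \<le> prob R"
      using ev by (auto intro: prob_diff_le_of_AE_iff)
    moreover have "prob down = prob up"
      unfolding down_def up_def
      using prob_L[of 0 "{l<..}"] prob_L[of t "{l<..}"] L[of t] L[of 0]
      by (intro exit_eq_entrance) auto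
    ultimately have main: "\<bar>prob down1 - prob up1\<bar> \<le> 2 * prob R" by linarith
    have "down1 = (L 0 -` {l<..} \<inter> space M) \<inter> {\<omega>\<in>space M. N \<omega> = 1}"
      by (auto simp: down1_def)
    also have "prob \<dots> = prob (L 0 -` {l<..} \<inter> space M) * prob {\<omega>\<in>space M. N \<omega> = 1}"
      unfolding N_def by (rule indep_setD[OF indep0]) (use poisson_P(4) in auto)
    also have "prob (L 0 -` {l<..} \<inter> space M) = measure \<pi> {l<..}"
      using prob_L[of 0 "{l<..}"] by (simp add: vimage_def Int_def conj_commute)
    also have "prob {\<omega>\<in>space M. N \<omega> = 1} = t * exp (- t)"
      unfolding N_def poisson_P(3) by simp
    finally have p_down: "prob down1 = measure \<pi> {l<..} * (t * exp (- t))" .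
    have "up1 = (L 0 -` {l} \<inter> space M) \<inter> (space M - {\<omega>\<in>space M. B (r l) \<omega> = 0})"
      by (auto simp: up1_def)
    also have "prob \<dots> = prob (L 0 -` {l} \<inter> space M) * prob (space M - {\<omega>\<in>space M. B (r l) \<omega> = 0})"
      unfolding B_def
      by (rule indep_setD[OF indep0]) (use poisson_B(4)[OF r(1) r(1)] in \<open>auto intro: sigma_sets.Compl\<close>)
    also have "prob (L 0 -` {l} \<inter> space M) = measure \<pi> {l}"
      using prob_L[of 0 "{l}"] by (simp add: vimage_def Int_def conj_commute)
    also have "prob (space M - {\<omega>\<in>space M. B (r l) \<omega> = 0}) = 1 - exp (- (r l * t))"
    proof -
      have "prob (space M - {\<omega>\<in>space M. B (r l) \<omega> = 0}) = 1 - prob {\<omega>\<in>space M. B (r l) \<omega> = 0}"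
        using sets_Collect_counts[OF B[OF r(1)] B[OF r(1)], of "\<lambda>i _. i = 0" l l]
        by (rule prob_compl)
      then show ?thesis unfolding B_def poisson_B(3)[OF r(1) r(1)] box(3)[OF r(1)] by (simp add: mult.commute)
    qed
    finally have p_up: "prob up1 = measure \<pi> {l} * (1 - exp (- (r l * t)))" .
    have "prob R = 1 - prob {\<omega>\<in>space M. B K \<omega> + N \<omega> \<le> 1}"
    proof -
      have "R = space M - {\<omega>\<in>space M. B K \<omega> + N \<omega> \<le> 1}" by (auto simp: R_def)
      then show ?thesis
        using sets_Collect_counts[OF B[OF \<open>K \<ge> 0\<close>] N, of "\<lambda>i j. i + j \<le> 1"]
        by (simp only: prob_compl)
    qed
    also have "prob {\<omega>\<in>space M. B K \<omega> + N \<omega> \<le> 1} =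
        exp (- (t * K)) * exp (- t) + t * K * exp (- (t * K)) * exp (- t)
        + exp (- (t * K)) * (t * exp (- t))"
      unfolding N_def B_def
      by (subst prob_indep_counts_sum_le_1[OF indep poisson_B(4)[OF \<open>K \<ge> 0\<close> \<open>K \<ge> 0\<close>] poisson_P(4)])
        (simp add: poisson_B(3)[OF \<open>K \<ge> 0\<close> \<open>K \<ge> 0\<close>] box(3)[OF \<open>K \<ge> 0\<close>] poisson_P(3))
    also have "\<dots> = exp (- ((1 + K) * t)) * (1 + (1 + K) * t)"
    proof -
      have "exp (- ((1 + K) * t)) = exp (- (t * K)) * exp (- t)"
        by (simp add: algebra_simps flip: exp_add)
      then show ?thesis by (simp add: algebra_simps)
    qed
    finally show "\<bar>measure \<pi> {l<..} * (t * exp (- t)) - measure \<pi> {l} * (1 - exp (- (r l * t)))\<bar>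
      \<le> 2 * (1 - exp (- ((1 + K) * t)) * (1 + (1 + K) * t))"
      using main p_down p_up by simp
  qed
  then show ?thesis
    unfolding psi_pc_mult[OF \<pi>, symmetric] r_def by (simp only: mult.left_commute)
qed

section \<open>Asymptotics of the tail recursion\<close>

text \<open>
  The difference of the two sides, \<open>f\<^sub>k\<close>, satisfies
  \<open>f\<^bsub>k+1\<^esub> = w f\<^sub>k + (k + 1) v\<^sup>k (v - w)\<^sup>2\<close>. The inequality is used for \<open>(v, w)\<close> and for \<open>(w, v)\<close>,
  giving \<open>(k + 1) w (v\<^sup>k - w\<^sup>k) \<le> k (v\<^bsup>k+1\<^esup> - w\<^bsup>k+1\<^esup>) \<le> (k + 1) v (v\<^sup>k - w\<^sup>k)\<close>.
\<close>

lemma weighted_am_gm_power: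
  fixes v w :: real
  assumes "0 \<le> v" "0 \<le> w"
  shows "real (Suc k) * w * v ^ k \<le> real k * v ^ Suc k + w ^ Suc k"
proof (induction k)
  case (Suc k)
  have "real (Suc k) * v ^ Suc (Suc k) + w ^ Suc (Suc k) - real (Suc (Suc k)) * w * v ^ Suc k
      = w * (real k * v ^ Suc k + w ^ Suc k - real (Suc k) * w * v ^ k)
        + real (Suc k) * v ^ k * (v - w)\<^sup>2"
    by (simp add: algebra_simps power2_eq_square)
  also have "\<dots> \<ge> 0"
    using Suc assms by (intro add_nonneg_nonneg mult_nonneg_nonneg) auto
  finally show ?case by linarith
qed auto

text \<open>
  The tails of the invariant distribution, with \<open>k = d - 1\<close>: the quantity with
  nearly constant decrements is \<open>\<xi>\<^sub>n\<^sup>k\<close>.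
\<close>

locale tail_recursion =
  fixes k :: nat and \<beta> :: real and \<xi> :: "nat \<Rightarrow> real"
  assumes k: "k \<ge> 1" and \<beta>: "\<beta> > 0" and start: "\<xi> 0 = 1"
    and nonneg: "\<And>n. 0 \<le> \<xi> n" and decr: "\<And>n. \<xi> (Suc n) \<le> \<xi> n"
    and rec: "\<And>n. \<xi> (Suc n) = \<beta> * (\<xi> n ^ Suc k - \<xi> (Suc n) ^ Suc k)"
begin

lemma pos: "0 < \<xi> n"
proof (induction n)
  case (Suc n)
  show ?case
  proof (rule ccontr)
    assume "\<not> 0 < \<xi> (Suc n)"
    then have "\<xi> (Suc n) = 0" using nonneg[of "Suc n"] by simp
    then show False using rec[of n] Suc \<beta> by simp
  qed
qed (simp add: start)

lemma power_decrement_le: "\<xi> n ^ k - \<xi> (Suc n) ^ k \<le> real k / (real (Suc k) * \<beta>)"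
proof -
  define v w where "v = \<xi> n" and "w = \<xi> (Suc n)"
  have vw: "0 < v" "0 < w" using pos by (auto simp: v_def w_def)
  have "real (Suc k) * w * (v ^ k - w ^ k) \<le> real k * (v ^ Suc k - w ^ Suc k)"
    using weighted_am_gm_power[of v w k] vw by (simp add: algebra_simps)
  also have "v ^ Suc k - w ^ Suc k = w / \<beta>"
    using rec[of n] \<beta> by (simp add: v_def w_def field_simps)
  finally have "w * (real (Suc k) * (v ^ k - w ^ k)) \<le> w * (real k / \<beta>)" by (simp add: mult_ac)
  then have "real (Suc k) * (v ^ k - w ^ k) \<le> real k / \<beta>"
    using vw by (simp only: mult_le_cancel_left_pos)
  then have "v ^ k - w ^ k \<le> real k / \<beta> / real (Suc k)"
    by (subst pos_le_divide_eq) (simp_all only: of_nat_0_less_iff zero_less_Suc mult.commute)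
  then show ?thesis by (simp add: v_def w_def mult.commute)
qed

lemma power_ge: "1 - real n * (real k / (real (Suc k) * \<beta>)) \<le> \<xi> n ^ k"
proof (induction n)
  case (Suc n)
  then show ?case using power_decrement_le[of n] unfolding of_nat_Suc distrib_right by linarith
qed (simp add: start)

text \<open>
  The lower bound loses the factor \<open>\<xi>\<^bsub>n+1\<^esub> / \<xi>\<^sub>n\<close>. The recursion gives
  \<open>(\<xi>\<^sub>n / \<xi>\<^bsub>n+1\<^esub>)\<^bsup>k+1\<^esup> = 1 + 1 / (\<beta> \<xi>\<^bsub>n+1\<^esub>\<^sup>k)\<close>, so the loss is controlled while \<open>\<xi>\<^bsub>n+1\<^esub>\<^sup>k \<ge> \<delta>\<close>.
\<close>

lemma power_decrement_ge:
  assumes "\<delta> > 0" "\<delta> \<le> \<xi> (Suc n) ^ k"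
  shows "real k / (real (Suc k) * \<beta>) / (1 + 1 / (\<beta> * \<delta>)) \<le> \<xi> n ^ k - \<xi> (Suc n) ^ k"
proof -
  define v w q where "v = \<xi> n" and "w = \<xi> (Suc n)" and "q = 1 + 1 / (\<beta> * \<delta>)"
  have vw: "0 < v" "0 < w" using pos by (auto simp: v_def w_def)
  have q: "q \<ge> 1" using \<beta> assms by (simp add: q_def)
  have step: "v ^ Suc k - w ^ Suc k = w / \<beta>"
    using rec[of n] \<beta> by (simp add: v_def w_def field_simps)
  have "v \<le> w * q"
  proof (rule ccontr)
    assume "\<not> v \<le> w * q"
    then have "(w * q) ^ Suc k < v ^ Suc k" using vw q by (intro power_strict_mono) auto
    moreover have "w ^ Suc k * q \<le> (w * q) ^ Suc k"
      unfolding power_mult_distrib using vw q by (intro mult_left_mono self_le_power) auto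
    moreover have "w ^ Suc k * q \<ge> w ^ Suc k + w / \<beta>"
    proof -
      have "w / \<beta> * 1 \<le> w / \<beta> * (w ^ k / \<delta>)"
        using vw \<beta> assms by (intro mult_left_mono) (auto simp: w_def)
      then show ?thesis by (simp add: q_def algebra_simps)
    qed
    ultimately show False using step by linarith
  qed
  then have "v / q \<le> w" using q by (simp add: field_simps)
  have "v * (real k / \<beta> / q) = real k / \<beta> * (v / q)" by simp
  also have "\<dots> \<le> real k / \<beta> * w" using \<open>v / q \<le> w\<close> \<beta> by (intro mult_left_mono) auto
  also have "\<dots> = real k * (v ^ Suc k - w ^ Suc k)" using step by simp
  also have "\<dots> \<le> v * (real (Suc k) * (v ^ k - w ^ k))"
    using weighted_am_gm_power[of w v k] vw by (simp add: algebra_simps)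
  finally have "real k / \<beta> / q \<le> real (Suc k) * (v ^ k - w ^ k)"
    using vw by (simp only: mult_le_cancel_left_pos)
  then have "real k / \<beta> / q / real (Suc k) \<le> v ^ k - w ^ k"
    by (subst pos_divide_le_eq) (simp_all only: of_nat_0_less_iff zero_less_Suc mult.commute)
  then show ?thesis by (simp add: v_def w_def q_def mult_ac)
qed

lemma power_le:
  assumes "\<delta> > 0" "\<delta> \<le> \<xi> n ^ k"
  shows "\<xi> n ^ k \<le> 1 - real n * (real k / (real (Suc k) * \<beta>) / (1 + 1 / (\<beta> * \<delta>)))"
  using assms(2)
proof (induction n)
  case (Suc n)
  have "\<xi> (Suc n) ^ k \<le> \<xi> n ^ k" using decr nonneg by (intro power_mono) auto
  then show ?case using Suc power_decrement_ge[OF assms(1) Suc.prems]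
    unfolding of_nat_Suc distrib_right by linarith
qed (simp add: start)

end

text \<open>
  The threshold \<open>\<delta> = 1 / \<surd>\<beta>\<close> tends to \<open>0\<close> while \<open>\<beta> \<delta> = \<surd>\<beta>\<close> tends to infinity, so the loss factor
  tends to \<open>1\<close>. Either \<open>\<xi>\<^sup>k\<close> is below the threshold, or the upper bound with this factor applies.
\<close>

lemma tail_recursion_limit:
  fixes \<xi> :: "real \<Rightarrow> nat \<Rightarrow> real" and N :: "real \<Rightarrow> nat"
  assumes rec: "\<And>\<beta>. \<beta> > 0 \<Longrightarrow> tail_recursion k \<beta> (\<xi> \<beta>)"
    and N: "\<And>\<beta>. \<beta> > 0 \<Longrightarrow> \<beta> * x \<le> real (N \<beta>) \<and> real (N \<beta>) \<le> \<beta> * x + 1"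
  shows "((\<lambda>\<beta>. \<xi> \<beta> (N \<beta>)) \<longlongrightarrow> root k (max 0 (1 - real k / real (Suc k) * x))) at_top"
proof -
  have k: "k > 0" using tail_recursion.k[OF rec[of 1]] by simp
  define c where "c = real k / real (Suc k)"
  have c: "c > 0" using k by (simp add: c_def)
  have "((\<lambda>\<beta>. \<xi> \<beta> (N \<beta>) ^ k) \<longlongrightarrow> max 0 (1 - c * x)) at_top"
  proof (rule tendsto_sandwich)
    have "((\<lambda>\<beta>. 1 - c * (x + 1 / \<beta>)) \<longlongrightarrow> 1 - c * x) at_top" by real_asymp
    then show "((\<lambda>\<beta>. max 0 (1 - c * (x + 1 / \<beta>))) \<longlongrightarrow> max 0 (1 - c * x)) at_top"
      by (intro tendsto_max tendsto_const)
    have "((\<lambda>\<beta>. 1 - c * x / (1 + 1 / sqrt \<beta>)) \<longlongrightarrow> 1 - c * x) at_top" by real_asymp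
    moreover have "((\<lambda>\<beta>. 1 / sqrt \<beta>) \<longlongrightarrow> 0) at_top" by real_asymp
    ultimately show "((\<lambda>\<beta>. max (1 / sqrt \<beta>) (1 - c * x / (1 + 1 / sqrt \<beta>)))
        \<longlongrightarrow> max 0 (1 - c * x)) at_top"
      by (intro tendsto_max)
    show "\<forall>\<^sub>F \<beta> in at_top. max 0 (1 - c * (x + 1 / \<beta>)) \<le> \<xi> \<beta> (N \<beta>) ^ k"
      using eventually_gt_at_top[of 0]
    proof eventually_elim
      case (elim \<beta>)
      interpret tail_recursion k \<beta> "\<xi> \<beta>" using rec elim by blast
      have "real (N \<beta>) / \<beta> \<le> x + 1 / \<beta>" using N[OF elim] elim by (simp add: field_simps)
      then have "c * (real (N \<beta>) / \<beta>) \<le> c * (x + 1 / \<beta>)" using c by (intro mult_left_mono) auto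
      moreover have "1 - c * (real (N \<beta>) / \<beta>) \<le> \<xi> \<beta> (N \<beta>) ^ k"
        using power_ge[of "N \<beta>"] by (simp add: c_def mult_ac)
      ultimately show ?case using nonneg[of "N \<beta>"] by simp
    qed
    show "\<forall>\<^sub>F \<beta> in at_top. \<xi> \<beta> (N \<beta>) ^ k \<le> max (1 / sqrt \<beta>) (1 - c * x / (1 + 1 / sqrt \<beta>))"
      using eventually_gt_at_top[of 0]
    proof eventually_elim
      case (elim \<beta>)
      interpret tail_recursion k \<beta> "\<xi> \<beta>" using rec elim by blast
      show ?case
      proof (cases "1 / sqrt \<beta> \<le> \<xi> \<beta> (N \<beta>) ^ k")
        case True
        have s: "\<beta> * (1 / sqrt \<beta>) = sqrt \<beta>" using elim by (simp add: real_div_sqrt)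
        have "\<xi> \<beta> (N \<beta>) ^ k \<le> 1 - real (N \<beta>) * (real k / (real (Suc k) * \<beta>) / (1 + 1 / sqrt \<beta>))"
          using power_le[OF _ True, unfolded s] elim by simp
        also have "\<dots> = 1 - c * (real (N \<beta>) / \<beta>) / (1 + 1 / sqrt \<beta>)" by (simp add: c_def)
        also have "\<dots> \<le> 1 - c * x / (1 + 1 / sqrt \<beta>)"
        proof -
          have "x \<le> real (N \<beta>) / \<beta>" using N[OF elim] elim by (simp add: field_simps)
          then show ?thesis using c elim
            by (intro diff_left_mono divide_right_mono mult_left_mono) auto
        qed
        finally show ?thesis by simp
      qed auto
    qed
  qed
  then have "((\<lambda>\<beta>. root k (\<xi> \<beta> (N \<beta>) ^ k)) \<longlongrightarrow> root k (max 0 (1 - c * x))) at_top"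
    by (rule tendsto_real_root)
  moreover have "\<forall>\<^sub>F \<beta> in at_top. root k (\<xi> \<beta> (N \<beta>) ^ k) = \<xi> \<beta> (N \<beta>)"
    using eventually_gt_at_top[of 0]
    by eventually_elim (use k tail_recursion.nonneg[OF rec] in \<open>auto intro: real_root_power_cancel\<close>)
  ultimately have "((\<lambda>\<beta>. \<xi> \<beta> (N \<beta>)) \<longlongrightarrow> root k (max 0 (1 - c * x))) at_top"
    by (rule Lim_transform_eventually)
  then show ?thesis by (simp only: c_def)
qed

section \<open>Convergence in distribution\<close>

lemma uniform_power_cdf:
  fixes U :: "'b \<Rightarrow> real"
  assumes "U \<in> borel_measurable S"
    and "distr S borel U = uniform_measure lborel {0..1}" and k: "k > 0" and c: "c > 0"
  shows "cdf (distr S borel (\<lambda>\<omega>. c * (1 - U \<omega> ^ k))) x =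
    (if x < 0 then 0 else 1 - root k (max 0 (1 - x / c)))"
proof -
  note [measurable] = assms(1)
  define A where "A = {u::real. c * (1 - u ^ k) \<le> x}"
  have [measurable]: "A \<in> sets borel" unfolding A_def by measurable
  have "cdf (distr S borel (\<lambda>\<omega>. c * (1 - U \<omega> ^ k))) x = measure (distr S borel U) A"
    unfolding cdf_def by (subst (1 2) measure_distr) (auto intro!: arg_cong[where f = "measure S"] simp: A_def)
  also have "\<dots> = measure lborel ({0..1} \<inter> A)"
    unfolding assms(2) by (subst measure_uniform_measure) auto
  also have "\<dots> = (if x < 0 then 0 else 1 - root k (max 0 (1 - x / c)))"
  proof (cases "x < 0")
    case True
    have "{0..1} \<inter> A = {}"
    proof (rule ccontr)
      assume "{0..1} \<inter> A \<noteq> {}"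
      then obtain u where u: "0 \<le> u" "u \<le> 1" "c * (1 - u ^ k) \<le> x" by (auto simp: A_def)
      then have "c * (1 - u ^ k) \<ge> 0" using c by (simp add: power_le_one)
      then show False using u True by simp
    qed
    then show ?thesis using True by simp
  next
    case False
    define g where "g = root k (max 0 (1 - x / c))"
    have g: "0 \<le> g" "g \<le> 1" "g ^ k = max 0 (1 - x / c)"
      using k c False by (auto simp: g_def real_root_le_1_iff)
    have "u \<in> A \<longleftrightarrow> g \<le> u" if "u \<in> {0..1}" for u
    proof -
      have "u \<in> A \<longleftrightarrow> g ^ k \<le> u ^ k"
        using that c by (auto simp: A_def g(3) field_simps)
      also have "\<dots> \<longleftrightarrow> g \<le> u" using that g k by (intro power_mono_iff) auto
      finally show ?thesis .
    qed
    then have "{0..1} \<inter> A = {g..1}" using g by auto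
    then show ?thesis using False g by (simp add: g_def)
  qed
  finally show ?thesis .
qed

lemma invariant_tail_recursion:
  assumes "\<beta> > 0" "d \<ge> 2" and inv: "invariant_distribution TYPE('w) (psi_pc d) \<beta> \<pi>"
  shows "tail_recursion (d - 1) \<beta> (\<lambda>n. measure \<pi> {n..})"
proof
  have \<pi>: "prob_space \<pi>" "sets \<pi> = UNIV" using inv by (auto simp: invariant_distribution_def)
  interpret prob_space \<pi> by (rule \<pi>)
  have "space \<pi> = UNIV" using \<pi> by (metis sets.top sets_eq_imp_space_eq sets_UNIV space_count_space sets_count_space Pow_UNIV)
  moreover have "{0::nat..} = UNIV" by auto
  ultimately show "measure \<pi> {0..} = 1" using prob_space by simp
  show "measure \<pi> {Suc n..} \<le> measure \<pi> {n..}" for n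
    using \<pi> by (intro finite_measure_mono) auto
  have "{Suc n..} = {n<..}" for n by auto
  then show "measure \<pi> {Suc n..} =
      \<beta> * (measure \<pi> {n..} ^ Suc (d - 1) - measure \<pi> {Suc n..} ^ Suc (d - 1))" for n
    using invariant_distribution_balance[OF assms(1) inv, of n] \<open>d \<ge> 2\<close> by simp
qed (use assms in auto)

theorem theorem5:
  fixes d :: nat
    and \<Omega> :: "real \<Rightarrow> 'a measure" and Y :: "real \<Rightarrow> 'a \<Rightarrow> nat"
    and S :: "'b measure" and U :: "'b \<Rightarrow> real"
  assumes "d \<ge> 2"
    and "\<And>\<beta>. \<beta> > 0 \<Longrightarrow> prob_space (\<Omega> \<beta>)"
    and "\<And>\<beta>. \<beta> > 0 \<Longrightarrow> Y \<beta> \<in> measurable (\<Omega> \<beta>) (count_space UNIV)"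
    and "\<And>\<beta>. \<beta> > 0 \<Longrightarrow>
      invariant_distribution TYPE('w) (psi_pc d) \<beta> (distr (\<Omega> \<beta>) (count_space UNIV) (Y \<beta>))"
    and "prob_space S"
    and "U \<in> borel_measurable S"
    and "distr S borel U = uniform_measure lborel {0..1}"
  shows "weak_conv_along at_top
    (\<lambda>\<beta>. distr (\<Omega> \<beta>) borel (\<lambda>\<omega>. real (Y \<beta> \<omega>) / \<beta>))
    (distr S borel (\<lambda>\<omega>. real d / (real d - 1) * (1 - U \<omega> ^ (d - 1))))"
  unfolding weak_conv_along_def
proof (intro allI impI)
  fix x
  define k where "k = d - 1"
  have k: "k > 0" "d = Suc k" using \<open>d \<ge> 2\<close> by (auto simp: k_def)
  define F where "F \<beta> = cdf (distr (\<Omega> \<beta>) borel (\<lambda>\<omega>. real (Y \<beta> \<omega>) / \<beta>)) x" for \<beta>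
  define \<pi> where "\<pi> \<beta> = distr (\<Omega> \<beta>) (count_space UNIV) (Y \<beta>)" for \<beta>
  have F: "F \<beta> = measure (\<pi> \<beta>) {n. real n / \<beta> \<le> x}" if "\<beta> > 0" for \<beta>
  proof -
    note [measurable] = assms(3)[OF that]
    show ?thesis unfolding F_def cdf_def \<pi>_def
      by (subst (1 2) measure_distr) (auto intro!: arg_cong[where f = "measure (\<Omega> \<beta>)"])
  qed
  have "(F \<longlongrightarrow> (if x < 0 then 0 else 1 - root k (max 0 (1 - real k / real (Suc k) * x)))) at_top"
  proof (cases "x < 0")
    case True
    have "F \<beta> = 0" if "\<beta> > 0" for \<beta>
    proof -
      have "{n. real n / \<beta> \<le> x} = {}"
        using that True by (auto simp: not_le intro!: less_le_trans[of x 0])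
      then show ?thesis using F[OF that] by simp
    qed
    then show ?thesis using True
      by (auto intro!: tendsto_eventually eventually_mono[OF eventually_gt_at_top[of 0]])
  next
    case False
    (* The least integer above beta * x, so that the tail from N on is the event Y / beta > x. *)
    define N where "N \<beta> = Suc (nat \<lfloor>\<beta> * x\<rfloor>)" for \<beta>
    have N: "\<beta> * x \<le> real (N \<beta>) \<and> real (N \<beta>) \<le> \<beta> * x + 1" if "\<beta> > 0" for \<beta>
      using that False by (auto simp: N_def) linarith+
    have "F \<beta> = 1 - measure (\<pi> \<beta>) {N \<beta>..}" if "\<beta> > 0" for \<beta>
    proof -
      interpret prob_space "\<pi> \<beta>"
        unfolding \<pi>_def using assms(2,3)[OF that] by (rule prob_space.prob_space_distr)
      have "0 \<le> \<beta> * x" using that False by simp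
      have "real n / \<beta> \<le> x \<longleftrightarrow> n < N \<beta>" for n
      proof -
        have "real n / \<beta> \<le> x \<longleftrightarrow> real n \<le> \<beta> * x" using that by (simp add: field_simps)
        also have "\<dots> \<longleftrightarrow> int n \<le> \<lfloor>\<beta> * x\<rfloor>" by (simp add: le_floor_iff)
        also have "\<dots> \<longleftrightarrow> n < N \<beta>" using \<open>0 \<le> \<beta> * x\<close>
          by (simp add: N_def less_Suc_eq_le le_nat_iff)
        finally show ?thesis .
      qed
      moreover have "space (\<pi> \<beta>) = UNIV" by (simp add: \<pi>_def)
      ultimately have eq: "{n. real n / \<beta> \<le> x} = space (\<pi> \<beta>) - {N \<beta>..}"
        by (simp add: set_eq_iff not_le)
      have "{N \<beta>..} \<in> sets (\<pi> \<beta>)" by (simp add: \<pi>_def)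
      then show ?thesis unfolding F[OF that] eq by (rule prob_compl)
    qed
    then have "\<forall>\<^sub>F \<beta> in at_top. 1 - measure (\<pi> \<beta>) {N \<beta>..} = F \<beta>"
      by (intro eventually_mono[OF eventually_gt_at_top[of 0]]) simp
    moreover have "((\<lambda>\<beta>. 1 - measure (\<pi> \<beta>) {N \<beta>..})
        \<longlongrightarrow> 1 - root k (max 0 (1 - real k / real (Suc k) * x))) at_top"
      by (rule tendsto_diff[OF tendsto_const], rule tail_recursion_limit[OF _ N])
        (use invariant_tail_recursion[OF _ \<open>d \<ge> 2\<close> assms(4)] in \<open>auto simp: \<pi>_def k_def\<close>)
    ultimately show ?thesis using False by (simp only: if_False) (rule Lim_transform_eventually)
  qed
  also have "(if x < 0 then 0 else 1 - root k (max 0 (1 - real k / real (Suc k) * x)))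
      = cdf (distr S borel (\<lambda>\<omega>. real d / (real d - 1) * (1 - U \<omega> ^ (d - 1)))) x"
    unfolding k_def[symmetric] using k
    by (subst uniform_power_cdf[OF assms(6,7)]) (auto simp: mult.commute)
  finally show "((\<lambda>\<beta>. cdf (distr (\<Omega> \<beta>) borel (\<lambda>\<omega>. real (Y \<beta> \<omega>) / \<beta>)) x) \<longlongrightarrow>
      cdf (distr S borel (\<lambda>\<omega>. real d / (real d - 1) * (1 - U \<omega> ^ (d - 1)))) x) at_top"
    unfolding F_def .
qed

end
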